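(* Let $G$ be a topological group and let $G'\subseteq G$ be a subgroup such that its closure $\overline{G'}$ in $G$ is a sequential $k_\omega$ group that is not Fréchet. Then $G'$ contains a subspace that is homeomorphic to the sequential fan $S(\omega)$ and is closed in $G$.
   Context: Topological groups are Hausdorff. A space $X$ is sequential if for every non-closed $A\subseteq X$ there is a sequence of points of $A$ converging to a point not in $A$. A space $X$ is Fréchet if for every $A\subseteq X$ and every $x\in\overline{A}$ there is a sequence of points of $A$ converging to $x$. A topology on $X$ is determined by a family $\mathcal K$ of subsets of $X$, each $K\in\mathcal K$ carrying a topology $\tau_K$, if $U\subseteq X$ is open exactly when $U\cap K$ is $\tau_K$-open for every $K\in\mathcal K$. A space is $k_\omega$ if its topology is determined by a countable cover $\mathcal K$ by compact Hausdorff $(K,\tau_K)$ such that for all $K,F\in\mathcal K$ the set $K\cap F$ is closed in both $K$ and $F$ and inherits the same topology from both; a $k_\omega$ group is a topological group whose underlying space is $k_\omega$. The sequential fan $S(\omega)$ is the set $\omega^2\cup\{0\}$ in which every point of $\omega^2$ is isolated and the basic neighborhoods of $0$ are $U_f=\{0\}\cup\{(i,j): j\ge f(i)\}$ for $f:\omega\to\omega$. *)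

theory Defs
  imports "HOL-Analysis.Analysis" "HOL-Algebra.Group"
begin

definition sequential_space :: "'a topology \<Rightarrow> bool" where
  "sequential_space X \<longleftrightarrow>
     (\<forall>A. A \<subseteq> topspace X \<and> \<not> closedin X A \<longrightarrow>
        (\<exists>s x. range s \<subseteq> A \<and> x \<notin> A \<and> limitin X s x sequentially))"

definition Frechet_space :: "'a topology \<Rightarrow> bool" where
  "Frechet_space X \<longleftrightarrow>
     (\<forall>A x. A \<subseteq> topspace X \<and> x \<in> X closure_of A \<longrightarrow>
        (\<exists>s. range s \<subseteq> A \<and> limitin X s x sequentially))"

definition determined_by :: "'a topology \<Rightarrow> 'a set set \<Rightarrow> ('a set \<Rightarrow> 'a topology) \<Rightarrow> bool" where
  "determined_by X \<K> \<tau> \<longleftrightarrow>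
     (\<forall>K\<in>\<K>. K \<subseteq> topspace X \<and> topspace (\<tau> K) = K) \<and>
     (\<forall>U. U \<subseteq> topspace X \<longrightarrow> (openin X U \<longleftrightarrow> (\<forall>K\<in>\<K>. openin (\<tau> K) (U \<inter> K))))"

definition k_omega_space :: "'a topology \<Rightarrow> bool" where
  "k_omega_space X \<longleftrightarrow>
     (\<exists>\<K> \<tau>. countable \<K> \<and> \<Union>\<K> = topspace X \<and> determined_by X \<K> \<tau> \<and>
        (\<forall>K\<in>\<K>. compact_space (\<tau> K) \<and> Hausdorff_space (\<tau> K)) \<and>
        (\<forall>K\<in>\<K>. \<forall>F\<in>\<K>.
           closedin (\<tau> K) (K \<inter> F) \<and> closedin (\<tau> F) (K \<inter> F) \<and>
           subtopology (\<tau> K) (K \<inter> F) = subtopology (\<tau> F) (K \<inter> F)))"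

definition topological_group :: "('a, 'b) monoid_scheme \<Rightarrow> 'a topology \<Rightarrow> bool" where
  "topological_group G T \<longleftrightarrow>
     group G \<and> topspace T = carrier G \<and> Hausdorff_space T \<and>
     continuous_map (prod_topology T T) T (\<lambda>(x, y). x \<otimes>\<^bsub>G\<^esub> y) \<and>
     continuous_map T T (\<lambda>x. inv\<^bsub>G\<^esub> x)"

definition k_omega_group :: "('a, 'b) monoid_scheme \<Rightarrow> 'a topology \<Rightarrow> bool" where
  "k_omega_group G T \<longleftrightarrow> topological_group G T \<and> k_omega_space T"

(* The points of the fan are encoded as (nat * nat) option: None is the non-isolated point 0,
   and Some (i, j) is the isolated point (i, j). *)
definition fan_nhd :: "(nat \<Rightarrow> nat) \<Rightarrow> (nat \<times> nat) option set" where
  "fan_nhd f = insert None {Some (i, j) | i j. f i \<le> j}"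

definition sequential_fan :: "(nat \<times> nat) option topology" where
  "sequential_fan = topology (\<lambda>U. None \<in> U \<longrightarrow> (\<exists>f. fan_nhd f \<subseteq> U))"

lemma openin_sequential_fan:
  "openin sequential_fan U \<longleftrightarrow> (None \<in> U \<longrightarrow> (\<exists>f. fan_nhd f \<subseteq> U))"
proof -
  have Int: "\<exists>h. fan_nhd h \<subseteq> S \<inter> T" if "fan_nhd f \<subseteq> S" "fan_nhd g \<subseteq> T" for f g S T
  proof
    show "fan_nhd (\<lambda>i. max (f i) (g i)) \<subseteq> S \<inter> T"
      using that by (auto simp: fan_nhd_def)
  qed
  have "istopology (\<lambda>U. None \<in> U \<longrightarrow> (\<exists>f. fan_nhd f \<subseteq> U))"
    unfolding istopology_def by (intro conjI allI impI) (blast intro: Int, blast)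
  then show ?thesis
    by (simp add: sequential_fan_def)
qed

lemma topspace_sequential_fan [simp]: "topspace sequential_fan = UNIV"
  using openin_subset[of sequential_fan UNIV] by (auto simp: openin_sequential_fan)

end

theory Submission
  imports Defs "HOL-Library.Countable_Set_Type"
begin

text \<open>
  Let \<open>H\<close> be the closure of \<open>G'\<close>, and suppose first that for every compact \<open>K \<subseteq> H\<close> there is a
  sequence in \<open>G' - K\<close> converging to \<open>1\<close>. If \<open>F n\<close> are the compact sets determining the topology of
  \<open>H\<close>, choose the columns of a fan one after the other, the \<open>n\<close>-th one outside \<open>F 0, \<dots>, F n\<close>. Every
  \<open>F n\<close> then meets only finitely many columns, so the fan is closed and carries the right topology.

  Otherwise some compact \<open>K\<close> contains a tail of every null sequence of \<open>G'\<close>. Then for \<open>A \<subseteq> G'\<close> every \<open>t\<close>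
  in the closure of \<open>A\<close> is already in the closure of \<open>A \<inter> K t\<close>; for \<open>A = G' - K\<close> and \<open>t = 1\<close> this says
  that \<open>K\<close> is a neighbourhood of \<open>1\<close>. A compact sequential space has countable local \<open>\<pi>\<close>-bases, and in
  a group a countable local \<open>\<pi>\<close>-base \<open>W m\<close> at \<open>1\<close> gives the countable neighbourhood base
  \<open>W m (W m)\<^sup>-\<^sup>1\<close>. So \<open>H\<close> is first countable and hence Frechet, a contradiction.
\<close>

section \<open>Sequential spaces and countable local \<open>\<pi>\<close>-bases\<close>

lemma sequential_space_closedinI:
  assumes "sequential_space X" "A \<subseteq> topspace X"
    and "\<And>s x. range s \<subseteq> A \<Longrightarrow> limitin X s x sequentially \<Longrightarrow> x \<in> A"
  shows "closedin X A"
  using assms unfolding sequential_space_def by blast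

lemma sequential_space_closed_subtopology:
  assumes "sequential_space X" "closedin X C"
  shows "sequential_space (subtopology X C)"
  unfolding sequential_space_def
proof (intro allI impI, elim conjE)
  fix A assume A: "A \<subseteq> topspace (subtopology X C)" "\<not> closedin (subtopology X C) A"
  have "\<not> closedin X A" "A \<subseteq> topspace X" "A \<subseteq> C"
    using A closedin_subset_topspace by auto
  then obtain s x where s: "range s \<subseteq> A" "x \<notin> A" "limitin X s x sequentially"
    using assms(1) unfolding sequential_space_def by blast
  then have sC: "\<And>n. s n \<in> C" using \<open>A \<subseteq> C\<close> by blast
  then have "x \<in> C"
    using limitin_closedin[OF s(3) assms(2)] by simp
  then show "\<exists>s x. range s \<subseteq> A \<and> x \<notin> A \<and> limitin (subtopology X C) s x sequentially"
    using s sC by (auto simp: limitin_subtopology intro!: exI[of _ s] exI[of _ x])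
qed

text \<open>If no value recurs infinitely often, the range has an accumulation point
  \<open>z\<close>, and removing \<open>z\<close> leaves a set that is not closed; sequentiality
  then supplies a convergent sequence of terms. The indices \<open>k\<close> tend to infinity but
  need not increase.\<close>

lemma sequential_compact_subsequence:
  assumes X: "sequential_space X" "Hausdorff_space X" and C: "compactin X C" and x: "range x \<subseteq> C"
  obtains k :: "nat \<Rightarrow> nat" and w
  where "filterlim k sequentially sequentially" "limitin X (\<lambda>j. x (k j)) w sequentially"
proof (cases "\<exists>v. infinite {n. x n = v}")
  case True
  then obtain v where v: "infinite {n. x n = v}" by blast
  then obtain r :: "nat \<Rightarrow> nat" where r: "strict_mono r" "\<And>n. r n \<in> {n. x n = v}"
    using infinite_enumerate by blast
  have xv: "x (r n) = v" for n using r(2) by simp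
  then have "v \<in> topspace X"
    using x compactin_subset_topspace[OF C] by (metis rangeI subsetD)
  show ?thesis
    using that[of r v] filterlim_subseq[OF r(1)] \<open>v \<in> topspace X\<close> xv by simp
next
  case False
  then have fin: "finite {n. x n = v}" for v by blast
  have "infinite (range x)"
  proof
    assume "finite (range x)"
    then have "finite (\<Union>v\<in>range x. {n. x n = v})" using fin by blast
    moreover have "(\<Union>v\<in>range x. {n. x n = v}) = UNIV" by auto
    ultimately show False by simp
  qed
  then obtain z where z: "z \<in> X derived_set_of (range x)"
    using compactin_imp_Bolzano_Weierstrass[OF C, of "range x"] x by blast
  define A where "A = range x - {z}"
  have sub: "A \<subseteq> topspace X" using x compactin_subset_topspace[OF C] A_def by blast
  have "\<not> closedin X A"
  proof
    assume "closedin X A"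
    then have "openin X (topspace X - A)" by blast
    moreover have "z \<in> topspace X - A" using z by (auto simp: in_derived_set_of A_def)
    ultimately obtain y where "y \<noteq> z" "y \<in> range x" "y \<in> topspace X - A"
      using z unfolding in_derived_set_of by blast
    then show False by (simp add: A_def)
  qed
  then obtain s w where s: "range s \<subseteq> A" "w \<notin> A" "limitin X s w sequentially"
    using X(1) sub unfolding sequential_space_def by blast
  have "\<forall>j. \<exists>n. s j = x n" using s(1) A_def by blast
  then obtain k where k: "\<And>j. s j = x (k j)" by metis
  \<comment> \<open>An index used infinitely often would give a constant subsequence and so force
    the limit \<open>w\<close> into \<open>A\<close>.\<close>
  have fink: "finite {j. k j = m}" for m
  proof (rule ccontr)
    assume inf: "infinite {j. k j = m}"
    then obtain r :: "nat \<Rightarrow> nat" where r: "strict_mono r" "\<And>n. r n \<in> {j. k j = m}"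
      using infinite_enumerate by blast
    have m: "s (r n) = x m" for n using k r(2) by simp
    then have "x m \<in> A" using s(1) by (metis rangeI subsetD)
    have "limitin X (\<lambda>n. x m) w sequentially"
      using limitin_subsequence[OF r(1) s(3)] by (simp add: o_def m)
    moreover have "limitin X (\<lambda>n. x m) (x m) sequentially"
      using \<open>x m \<in> A\<close> sub by auto
    ultimately have "w = x m"
      using limitin_Hausdorff_unique[OF _ _ _ X(2)] by (metis sequentially_bot)
    then show False using \<open>x m \<in> A\<close> s(2) by blast
  qed
  have "filterlim k sequentially sequentially"
    unfolding filterlim_at_top
  proof
    fix M
    have "{j. \<not> M \<le> k j} = (\<Union>m<M. {j. k j = m})" by auto
    then have "finite {j. \<not> M \<le> k j}" using fink by simp
    then show "\<forall>\<^sub>F j in sequentially. M \<le> k j"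
      by (simp add: eventually_cofinite flip: cofinite_eq_sequentially)
  qed
  moreover have "s = (\<lambda>j. x (k j))" using k by blast
  ultimately show ?thesis using that s(3) by blast
qed

text \<open>\<open>R\<close> is the strict part of the cardinal successor of \<open>natLeq\<close>,
  a well-order of type omega_1; \<open>cardSuc\<close> lives on sets, hence the type
  \<open>nat set\<close>. An unbounded countable subset would make the field a countable union of
  countable initial segments.\<close>

lemma omega1_order:
  includes cardinal_syntax
  obtains R :: "nat set rel" and I
  where "wf R" "trans R" "total_on I R" "R \<subseteq> I \<times> I"
    and "\<And>i. countable {j. (j, i) \<in> R}"
    and "\<And>C. C \<subseteq> I \<Longrightarrow> countable C \<Longrightarrow> \<exists>i\<in>I. \<forall>c\<in>C. (c, i) \<in> R"
proof -
  define r where "r = cardSuc natLeq"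
  have Cr: "Card_order r" unfolding r_def by (rule cardSuc_Card_order[OF natLeq_Card_order])
  then have W: "Well_order r" by (rule card_order_on_well_order_on)
  have less: "natLeq <o r" unfolding r_def by (rule cardSuc_greater[OF natLeq_Card_order])
  define R where "R = r - Id"
  have lin: "Linear_order r" and "wf R"
    using W by (auto simp: well_order_on_def R_def)
  then have tr: "trans r" and an: "antisym r" and tot: "total_on (Field r) r"
    by (auto simp: linear_order_on_def partial_order_on_def preorder_on_def)
  have "trans R" unfolding R_def by (rule trans_diff_Id[OF tr an])
  have totR: "total_on (Field r) R" using tot by (auto simp: R_def total_on_def)
  have RF: "R \<subseteq> Field r \<times> Field r" by (auto simp: R_def Field_def)
  have cI: "countable {j. (j, i) \<in> R}" for i
  proof (cases "i \<in> Field r")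
    case True
    have eq: "{j. (j, i) \<in> R} = underS r i" by (auto simp: R_def underS_def)
    have "|underS r i| <o r" by (rule card_of_underS[OF Cr True])
    then have "|underS r i| \<le>o natLeq"
      unfolding r_def
      using cardSuc_ordLeq_ordLess[OF card_of_Card_order natLeq_Card_order]
      by (simp add: cardSuc_ordLeq_ordLess natLeq_Card_order card_of_Card_order)
    then show ?thesis by (simp add: eq countable_card_le_natLeq)
  next
    case False
    then have "{j. (j, i) \<in> R} = {}" using RF by blast
    then show ?thesis by simp
  qed
  have "\<exists>i\<in>Field r. \<forall>c\<in>C. (c, i) \<in> R" if C: "C \<subseteq> Field r" "countable C" for C
  proof (rule ccontr)
    assume not: "\<not> ?thesis"
    have "Field r \<subseteq> (\<Union>c\<in>C. insert c {j. (j, c) \<in> R})"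
    proof
      fix i assume i: "i \<in> Field r"
      then obtain c where "c \<in> C" "(c, i) \<notin> R" using not by blast
      then show "i \<in> (\<Union>c\<in>C. insert c {j. (j, c) \<in> R})"
        using totR i C(1) unfolding total_on_def by blast
    qed
    moreover have "countable (\<Union>c\<in>C. insert c {j. (j, c) \<in> R})"
      using C(2) cI by blast
    ultimately have "countable (Field r)" by (rule countable_subset)
    then have "|Field r| \<le>o natLeq" by (simp add: countable_card_le_natLeq)
    moreover have "r =o |Field r|" using card_of_Field_ordIso[OF Cr] ordIso_symmetric by blast
    ultimately have "r \<le>o natLeq" using ordIso_ordLeq_trans by blast
    then show False using less not_ordLess_ordLeq by blast
  qed
  then show ?thesis using that \<open>wf R\<close> \<open>trans R\<close> totR RF cI by blast
qed

lemma finite_total_on_greatest: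
  assumes "finite E" "E \<noteq> {}" "E \<subseteq> I" "total_on I R" "trans R"
  shows "\<exists>g\<in>E. \<forall>x\<in>E - {g}. (x, g) \<in> R"
  using assms(1-3)
proof (induction rule: finite_ne_induct)
  case (singleton x)
  then show ?case by simp
next
  case (insert y F)
  then obtain g where g: "g \<in> F" "\<forall>x\<in>F - {g}. (x, g) \<in> R" by auto
  have "y \<noteq> g" "y \<in> I" "g \<in> I" using insert g by auto
  then consider "(y, g) \<in> R" | "(g, y) \<in> R"
    using assms(4) by (auto simp: total_on_def)
  then show ?case
  proof cases
    case 1
    then show ?thesis using g by auto
  next
    case 2
    then have "\<forall>x\<in>F. (x, y) \<in> R" using g assms(5) by (metis DiffI singletonD transD)
    then show ?thesis by auto
  qed
qed

lemma compact_space_fip_image: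
  assumes "compact_space X" and D: "\<And>i. i \<in> I \<Longrightarrow> closedin X (D i)"
    and fin: "\<And>J. finite J \<Longrightarrow> J \<subseteq> I \<Longrightarrow> \<Inter>(D ` J) \<noteq> {}"
  shows "\<Inter>(D ` I) \<noteq> {}"
proof -
  have fip: "\<And>\<U>. (\<forall>C\<in>\<U>. closedin X C) \<and> (\<forall>\<F>. finite \<F> \<and> \<F> \<subseteq> \<U> \<longrightarrow> \<Inter>\<F> \<noteq> {}) \<Longrightarrow> \<Inter>\<U> \<noteq> {}"
    using assms(1) compact_space_fip by metis
  show ?thesis
  proof (rule fip, intro conjI allI impI)
    show "\<forall>C\<in>D ` I. closedin X C" using D by simp
    fix \<F> assume F: "finite \<F> \<and> \<F> \<subseteq> D ` I"
    then obtain J where "J \<subseteq> I" "finite J" "\<F> = D ` J" using finite_subset_image by metis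
    then show "\<Inter>\<F> \<noteq> {}" using fin by metis
  qed
qed

text \<open>This is Shapirovskii's argument. If \<open>e\<close> has no countable local \<open>\<pi>\<close>-base, one chooses
  by recursion on \<open>\<omega>\<^sub>1\<close> neighbourhoods \<open>V i\<close> of \<open>e\<close> and open sets \<open>Y i\<close> with disjoint closures such
  that \<open>Y i\<close> meets every nonempty finite intersection of earlier sets. Compactness then yields a free
  sequence \<open>x\<close> of length \<open>\<omega>\<^sub>1\<close>. The union of the closures of its initial segments is sequentially
  closed, hence compact, but the closures of the \<open>V i\<close> have the finite intersection property on it
  without a common point.\<close>
lemma countable_local_pi_base:
  assumes X: "compact_space X" "Hausdorff_space X" "sequential_space X" and e: "e \<in> topspace X"
  obtains \<C> where "countable \<C>" "\<And>W. W \<in> \<C> \<Longrightarrow> openin X W \<and> W \<noteq> {}"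
    "\<And>U. openin X U \<Longrightarrow> e \<in> U \<Longrightarrow> \<exists>W\<in>\<C>. W \<subseteq> U"
proof (rule ccontr)
  assume no: "\<not> thesis"
  note witness = that
  obtain R :: "nat set rel" and I where R: "wf R" "trans R" "total_on I R" "R \<subseteq> I \<times> I"
    and cR: "\<And>i. countable {j. (j, i) \<in> R}"
    and bd: "\<And>C. C \<subseteq> I \<Longrightarrow> countable C \<Longrightarrow> \<exists>i\<in>I. \<forall>c\<in>C. (c, i) \<in> R"
    using omega1_order by blast
  have irr: "(i, i) \<notin> R" for i using R(1) by (simp add: wf_irrefl)
  define fam where "fam f i = fst ` f ` {j. (j, i) \<in> R} \<union> snd ` f ` {j. (j, i) \<in> R}"
    for f :: "nat set \<Rightarrow> 'a set \<times> 'a set" and i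
  \<comment> \<open>The components of \<open>p\<close> are the candidates for \<open>V i\<close> and
    \<open>Y i\<close>. Intersecting with \<open>topspace X\<close> keeps the empty family
    \<open>E\<close> inside the space.\<close>
  define P where "P f i p \<longleftrightarrow> openin X (fst p) \<and> openin X (snd p) \<and> e \<in> fst p \<and>
      X closure_of fst p \<inter> X closure_of snd p = {} \<and>
      (\<forall>E. finite E \<and> E \<subseteq> fam f i \<and> topspace X \<inter> \<Inter>E \<noteq> {} \<longrightarrow> topspace X \<inter> \<Inter>E \<inter> snd p \<noteq> {})"
    for f i and p :: "'a set \<times> 'a set"
  have "\<exists>p. P f i p" if IH: "\<And>y. (y, i) \<in> R \<Longrightarrow> P f y (f y)" for f i
  proof -
    \<comment> \<open>This countable family of nonempty open sets is no local \<pi>-base at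
      \<open>e\<close> by assumption, so some neighbourhood \<open>U\<close> of \<open>e\<close>
      contains none of its members. The complement of any subset of \<open>U\<close> then meets them
      all.\<close>
    define \<C> where "\<C> = {topspace X \<inter> \<Inter>E |E. finite E \<and> E \<subseteq> fam f i \<and> topspace X \<inter> \<Inter>E \<noteq> {}}"
    have "countable (fam f i)" unfolding fam_def using cR by blast
    then have "countable {E. finite E \<and> E \<subseteq> fam f i}"
      by (rule countable_Collect_finite_subset)
    moreover have "\<C> \<subseteq> (\<lambda>E. topspace X \<inter> \<Inter>E) ` {E. finite E \<and> E \<subseteq> fam f i}"
      by (auto simp: \<C>_def)
    ultimately have "countable \<C>" by (meson countable_image countable_subset)
    moreover have "openin X W \<and> W \<noteq> {}" if W: "W \<in> \<C>" for W
    proof -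
      obtain E where E: "W = topspace X \<inter> \<Inter>E" "finite E" "E \<subseteq> fam f i" "W \<noteq> {}"
        using W unfolding \<C>_def by blast
      have "openin X V" if "V \<in> E" for V
        using that E(3) IH unfolding fam_def P_def by blast
      then have "openin X (topspace X \<inter> \<Inter>E)"
      proof (cases "E = {}")
        case False
        then have "openin X (\<Inter>E)" using openin_Inter[OF E(2)] \<open>\<And>V. V \<in> E \<Longrightarrow> openin X V\<close> by blast
        then show ?thesis by blast
      qed auto
      then show ?thesis using E by blast
    qed
    ultimately have "\<not> (\<forall>U. openin X U \<longrightarrow> e \<in> U \<longrightarrow> (\<exists>W\<in>\<C>. W \<subseteq> U))"
      using no witness[of \<C>] by meson
    then obtain U where U: "openin X U" "e \<in> U" and nU: "\<And>W. W \<in> \<C> \<Longrightarrow> \<not> W \<subseteq> U"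
      by blast
    have nb: "neighbourhood_base_of (closedin X) X"
      using compact_Hausdorff_imp_regular_space[OF X(1,2)] by (simp add: neighbourhood_base_of_closedin)
    \<comment> \<open>Shrinking twice puts the open set \<open>V1\<close> between the closure of
      \<open>V\<close> and the complement of \<open>C1\<close>, which makes the two closures
      disjoint.\<close>
    then obtain V1 C1 where 1: "openin X V1" "closedin X C1" "e \<in> V1" "V1 \<subseteq> C1" "C1 \<subseteq> U"
      using U unfolding neighbourhood_base_of by metis
    then obtain V C where 2: "openin X V" "closedin X C" "e \<in> V" "V \<subseteq> C" "C \<subseteq> V1"
      using nb unfolding neighbourhood_base_of by metis
    have "X closure_of V \<subseteq> V1" using 2 closure_of_minimal by (metis subset_trans)
    moreover have "X closure_of (topspace X - C1) \<subseteq> topspace X - V1"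
      using 1 by (intro closure_of_minimal) auto
    moreover have "topspace X \<inter> \<Inter>E \<inter> (topspace X - C1) \<noteq> {}"
      if "finite E" "E \<subseteq> fam f i" "topspace X \<inter> \<Inter>E \<noteq> {}" for E
    proof
      assume "topspace X \<inter> \<Inter>E \<inter> (topspace X - C1) = {}"
      then have "topspace X \<inter> \<Inter>E \<subseteq> U" using 1 by blast
      moreover have "topspace X \<inter> \<Inter>E \<in> \<C>" using that by (auto simp: \<C>_def)
      ultimately show False using nU by blast
    qed
    ultimately have "P f i (V, topspace X - C1)"
      using 1 2 unfolding P_def by auto
    then show ?thesis ..
  qed
  moreover have "P f i p = P g i p" if "\<And>z. (z, i) \<in> R \<Longrightarrow> f z = g z" for f g i p
  proof -
    have "f ` {j. (j, i) \<in> R} = g ` {j. (j, i) \<in> R}" using that by auto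
    then have "fam f i = fam g i" by (simp add: fam_def)
    then show ?thesis by (simp add: P_def)
  qed
  ultimately obtain f where f: "\<And>i. P f i (f i)"
    using dependent_wf_choice[OF R(1), of P] by metis
  define V Y where "V i = fst (f i)" and "Y i = snd (f i)" for i
  have opV: "openin X (V i)" and opO: "openin X (Y i)" and eV: "e \<in> V i"
    and disj: "X closure_of V i \<inter> X closure_of Y i = {}"
    and meet: "finite E \<Longrightarrow> E \<subseteq> fam f i \<Longrightarrow> topspace X \<inter> \<Inter>E \<noteq> {} \<Longrightarrow> topspace X \<inter> \<Inter>E \<inter> Y i \<noteq> {}" for i E
    using f[of i] by (simp_all add: P_def V_def Y_def)
  \<comment> \<open>The induction removes the greatest index \<open>g\<close> of \<open>E\<close>:
    all remaining sets are earlier than \<open>g\<close>, so \<open>Y g\<close> meets their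
    intersection.\<close>
  have fin: "topspace X \<inter> \<Inter>(V ` F) \<inter> \<Inter>(Y ` E) \<noteq> {}"
    if "finite F" "finite E" "E \<subseteq> I" "\<And>i j. i \<in> F \<Longrightarrow> j \<in> E \<Longrightarrow> (i, j) \<in> R" for F E
    using that(2-4)
  proof (induction "card E" arbitrary: E)
    case 0
    then show ?case using e eV by auto
  next
    case (Suc n)
    then have "E \<noteq> {}" by auto
    then obtain g where g: "g \<in> E" "\<forall>x\<in>E - {g}. (x, g) \<in> R"
      using finite_total_on_greatest[OF Suc(3) _ Suc(4) R(3,2)] by blast
    have ne: "topspace X \<inter> \<Inter>(V ` F) \<inter> \<Inter>(Y ` (E - {g})) \<noteq> {}"
      using Suc g by (intro Suc(1)) auto
    have "V ` F \<union> Y ` (E - {g}) \<subseteq> fam f g"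
      using g Suc(5) by (auto simp: fam_def V_def Y_def image_image)
    then have "topspace X \<inter> \<Inter>(V ` F \<union> Y ` (E - {g})) \<inter> Y g \<noteq> {}"
      using ne that(1) Suc(3) by (intro meet) auto
    moreover have "\<Inter>(Y ` E) = Y g \<inter> \<Inter>(Y ` (E - {g}))" using g(1) by blast
    ultimately show ?case by (simp add: Inf_union_distrib inf.assoc inf.left_commute inf.commute)
  qed
  \<comment> \<open>These points form the free sequence: the point for \<open>a\<close> lies in the
    closure of \<open>V i\<close> for \<open>i\<close> before \<open>a\<close>, and in that of
    \<open>Y i\<close> from \<open>a\<close> on.\<close>
  have "\<exists>y\<in>topspace X. \<forall>i\<in>I. y \<in> (if (i, a) \<in> R then X closure_of V i else X closure_of Y i)" if "a \<in> I" for a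
  proof -
    define D where "D i = (if (i, a) \<in> R then X closure_of V i else X closure_of Y i)" for i
    have "\<Inter>(D ` I) \<noteq> {}"
    proof (rule compact_space_fip_image[OF X(1)])
      show "closedin X (D i)" for i by (simp add: D_def)
      fix J assume J: "finite J" "J \<subseteq> I"
      have "(i, j) \<in> R" if "i \<in> J" "j \<in> J" "(i, a) \<in> R" "(j, a) \<notin> R" for i j
      proof -
        have "j \<in> I" using that(2) J(2) by blast
        then have "j = a \<or> (a, j) \<in> R" using that(4) \<open>a \<in> I\<close> R(3) by (auto simp: total_on_def)
        then show ?thesis using that(3) transD[OF R(2)] by metis
      qed
      then have "topspace X \<inter> \<Inter>(V ` {i\<in>J. (i, a) \<in> R}) \<inter> \<Inter>(Y ` {i\<in>J. (i, a) \<notin> R}) \<noteq> {}"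
        using J by (intro fin) auto
      then obtain y where y: "\<And>i. i \<in> J \<Longrightarrow> (i, a) \<in> R \<Longrightarrow> y \<in> V i"
        "\<And>i. i \<in> J \<Longrightarrow> (i, a) \<notin> R \<Longrightarrow> y \<in> Y i" by blast
      have "y \<in> D i" if "i \<in> J" for i
        using y[OF that] closure_of_subset[OF openin_subset[OF opV]]
          closure_of_subset[OF openin_subset[OF opO]] unfolding D_def by auto
      then show "\<Inter>(D ` J) \<noteq> {}" by (metis INT_I empty_iff)
    qed
    then obtain y where "y \<in> \<Inter>(D ` I)" by blast
    then have y: "\<And>i. i \<in> I \<Longrightarrow> y \<in> D i" by blast
    then have "y \<in> D a" using that by blast
    then have "y \<in> topspace X" by (auto simp: D_def in_closure_of split: if_splits)
    then show ?thesis using y D_def by metis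
  qed
  then have "\<forall>a. \<exists>y. a \<in> I \<longrightarrow> y \<in> topspace X \<and>
      (\<forall>i\<in>I. y \<in> (if (i, a) \<in> R then X closure_of V i else X closure_of Y i))" by meson
  from choice[OF this] obtain x where xI: "\<forall>a. a \<in> I \<longrightarrow> x a \<in> topspace X \<and>
      (\<forall>i\<in>I. x a \<in> (if (i, a) \<in> R then X closure_of V i else X closure_of Y i))" ..
  have x: "x a \<in> topspace X" if "a \<in> I" for a using xI that by simp
  have xV: "x a \<in> X closure_of V i" if "a \<in> I" "(i, a) \<in> R" for a i
  proof -
    have "i \<in> I" using that(2) R(4) by blast
    then show ?thesis using xI[rule_format, OF that(1)] that(2) by auto
  qed
  have xO: "x a \<in> X closure_of Y i" if "a \<in> I" "i \<in> I" "(i, a) \<notin> R" for a i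
    using xI[rule_format, OF that(1)] that(2,3) by auto
  \<comment> \<open>On \<open>I\<close>, \<open>(a, b) \<notin> R\<close> means that
    \<open>b\<close> is at most \<open>a\<close>, so this is the closure of the initial segment up
    to and including \<open>a\<close>.\<close>
  define S where "S a = X closure_of (x ` {b\<in>I. (a, b) \<notin> R})" for a
  have S_mono: "S a \<subseteq> S b" if "(a, b) \<in> R" for a b
    unfolding S_def using that R(2) by (intro closure_of_mono image_mono) (auto dest: transD)
  have x_S: "x a \<in> S a" if "a \<in> I" for a
  proof -
    have "x a \<in> x ` {b\<in>I. (a, b) \<notin> R}" using that irr by simp
    then show ?thesis
      unfolding S_def using x by (intro subsetD[OF closure_of_subset]) auto
  qed
  have S_O: "S a \<subseteq> X closure_of Y a" if "a \<in> I" for a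
    unfolding S_def using that xO by (intro closure_of_minimal) auto
  have closed: "closedin X (\<Union>a\<in>I. S a)"
  proof (rule sequential_space_closedinI[OF X(3)])
    show "(\<Union>a\<in>I. S a) \<subseteq> topspace X" by (auto simp: S_def in_closure_of)
  next
    fix s w assume s: "range s \<subseteq> (\<Union>a\<in>I. S a)" "limitin X s w sequentially"
    then have "\<forall>n. \<exists>a\<in>I. s n \<in> S a" by blast
    then obtain c where c: "\<And>n. c n \<in> I" "\<And>n. s n \<in> S (c n)" by metis
    \<comment> \<open>Countably many stages have a common bound, so the whole sequence already lies
      in one closed set \<open>S a\<close>.\<close>
    then obtain a where a: "a \<in> I" "\<And>n. (c n, a) \<in> R" using bd[of "range c"] by auto
    then have "s n \<in> S a" for n using c(2) S_mono by blast
    then have "w \<in> S a" using limitin_closedin[OF s(2), of "S a"] by (simp add: S_def)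
    then show "w \<in> (\<Union>a\<in>I. S a)" using a(1) by blast
  qed
  \<comment> \<open>For finite \<open>J\<close>, a point \<open>x a\<close> with \<open>a\<close>
    above \<open>J\<close> lies in every \<open>T i\<close>. A point common to all
    \<open>T i\<close> lies in some \<open>S a\<close>, hence in the closures of both
    \<open>V a\<close> and \<open>Y a\<close>.\<close>
  define T where "T i = (\<Union>a\<in>I. S a) \<inter> X closure_of V i" for i
  have "\<Inter>(T ` I) \<noteq> {}"
  proof (rule compact_space_fip_image[OF X(1)])
    show "closedin X (T i)" for i
      unfolding T_def using closed closedin_closure_of by (rule closedin_Int)
    fix J assume "finite J" "J \<subseteq> I"
    then obtain a where a: "a \<in> I" "\<And>i. i \<in> J \<Longrightarrow> (i, a) \<in> R"
      using bd[of J] countable_finite by metis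
    have "x a \<in> T i" if "i \<in> J" for i using xV[OF a(1)] a x_S[OF a(1)] that by (auto simp: T_def)
    then show "\<Inter>(T ` J) \<noteq> {}" by (metis INT_I empty_iff)
  qed
  then obtain y where "y \<in> \<Inter>(T ` I)" by blast
  then have "\<And>i. i \<in> I \<Longrightarrow> y \<in> T i" by blast
  moreover have "I \<noteq> {}" using bd[of "{}"] by auto
  ultimately obtain a where "a \<in> I" "y \<in> S a" unfolding T_def by blast
  then have "y \<in> X closure_of Y a" "y \<in> X closure_of V a"
    using S_O \<open>\<And>i. i \<in> I \<Longrightarrow> y \<in> T i\<close>[of a] by (auto simp: T_def)
  then show False using disj[of a] by blast
qed

section \<open>Sequential topological groups\<close>

locale topgroup = group G for G (structure) +
  fixes X
  assumes topological_group: "topological_group G X"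
begin

lemma topspace_eq [simp]: "topspace X = carrier G"
  and Hausdorff: "Hausdorff_space X"
  and continuous_mult: "continuous_map (prod_topology X X) X (\<lambda>(x, y). x \<otimes> y)"
  and continuous_inv: "continuous_map X X (\<lambda>x. inv x)"
  using topological_group by (auto simp: topological_group_def)

lemma continuous_map_mult:
  assumes "continuous_map Y X f" "continuous_map Y X g"
  shows "continuous_map Y X (\<lambda>y. f y \<otimes> g y)"
proof -
  have "continuous_map Y (prod_topology X X) (\<lambda>y. (f y, g y))"
    using assms by (simp add: continuous_map_pairwise o_def)
  then show ?thesis
    using continuous_map_compose[OF _ continuous_mult, of Y "\<lambda>y. (f y, g y)"] by (simp add: o_def)
qed

lemma continuous_map_inv:
  assumes "continuous_map Y X f"
  shows "continuous_map Y X (\<lambda>y. inv (f y))"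
  using continuous_map_compose[OF assms continuous_inv] by (simp add: o_def)

lemma limitin_mult:
  assumes "limitin X s a F" "limitin X t b F"
  shows "limitin X (\<lambda>n. s n \<otimes> t n) (a \<otimes> b) F"
proof -
  have "limitin (prod_topology X X) (\<lambda>n. (s n, t n)) (a, b) F"
    using assms by (simp add: limitin_pairwise o_def)
  then show ?thesis
    using continuous_map_limit[OF continuous_mult] by (fastforce simp: o_def)
qed

lemma limitin_inv:
  assumes "limitin X s a F"
  shows "limitin X (\<lambda>n. inv (s n)) (inv a) F"
  using continuous_map_limit[OF continuous_inv assms] by (simp add: o_def)

lemma compactin_mult:
  assumes "compactin X K" "compactin X L"
  shows "compactin X {k \<otimes> l | k l. k \<in> K \<and> l \<in> L}"
proof -
  have "compactin X ((\<lambda>(x, y). x \<otimes> y) ` (K \<times> L))"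
    by (rule image_compactin[OF _ continuous_mult]) (use assms in \<open>simp add: compactin_Times\<close>)
  also have "(\<lambda>(x, y). x \<otimes> y) ` (K \<times> L) = {k \<otimes> l | k l. k \<in> K \<and> l \<in> L}" by auto
  finally show ?thesis .
qed

text \<open>If no term of a convergent sequence lies in \<open>K h\<close>, then suitable quotients of its terms
  form a null sequence outside \<open>K\<close>.\<close>
lemma convergent_sequence_meets_translate:
  assumes K: "closedin X K" and Q: "\<And>a b. a \<in> Q \<Longrightarrow> b \<in> Q \<Longrightarrow> a \<otimes> inv b \<in> Q"
    and null: "\<And>s. range s \<subseteq> Q - K \<Longrightarrow> \<not> limitin X s \<one> sequentially"
    and d: "range d \<subseteq> Q" "limitin X d h sequentially" and Q_sub: "Q \<subseteq> carrier G"
  shows "\<exists>j. d j \<otimes> inv h \<in> K"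
proof (rule ccontr)
  assume no: "\<not> ?thesis"
  have dG: "d j \<in> carrier G" and h: "h \<in> carrier G" for j
    using d Q_sub limitin_topspace[OF d(2)] by auto
  \<comment> \<open>For fixed \<open>j\<close> the quotients tend to
    \<open>d j \<otimes> inv h\<close>, which lies in the open complement of \<open>K\<close>. The
    bound \<open>l \<ge> j\<close> makes the chosen quotients converge to
    \<open>\<one>\<close>.\<close>
  have "\<exists>l\<ge>j. d j \<otimes> inv (d l) \<notin> K" for j
  proof -
    have "limitin X (\<lambda>l. d j \<otimes> inv (d l)) (d j \<otimes> inv h) sequentially"
      using dG by (intro limitin_mult limitin_inv d) simp
    moreover have "openin X (carrier G - K)" using K by (simp add: closedin_def)
    moreover have "d j \<otimes> inv h \<in> carrier G - K" using no dG h by blast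
    ultimately have "\<forall>\<^sub>F l in sequentially. d j \<otimes> inv (d l) \<in> carrier G - K"
      by (rule limitinD)
    then have "\<forall>\<^sub>F l in sequentially. l \<ge> j \<and> d j \<otimes> inv (d l) \<in> carrier G - K"
      using eventually_ge_at_top eventually_conj by blast
    then show ?thesis by (auto simp: eventually_sequentially)
  qed
  then obtain l where l: "\<And>j. l j \<ge> j" "\<And>j. d j \<otimes> inv (d (l j)) \<notin> K" by metis
  have "filterlim l sequentially sequentially"
    using filterlim_at_top_mono[OF filterlim_ident] l(1) always_eventually by metis
  then have "limitin X (\<lambda>j. d (l j)) h sequentially"
    using d(2) unfolding limitin_def filterlim_iff by blast
  then have "limitin X (\<lambda>j. d j \<otimes> inv (d (l j))) (h \<otimes> inv h) sequentially"
    by (intro limitin_mult limitin_inv d)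
  moreover have "range (\<lambda>j. d j \<otimes> inv (d (l j))) \<subseteq> Q - K"
    using l(2) Q d(1) by blast
  ultimately show False using null h by simp
qed

text \<open>The set of those \<open>t\<close> that lie in the closure of a countable subset of \<open>A \<inter> K t\<close> is
  sequentially closed.\<close>
lemma closure_of_Int_translate:
  assumes X: "sequential_space X" and K: "compactin X K" "\<one> \<in> K"
    and Q_sub: "Q \<subseteq> carrier G" and Q: "\<And>a b. a \<in> Q \<Longrightarrow> b \<in> Q \<Longrightarrow> a \<otimes> inv b \<in> Q"
    and null: "\<And>s. range s \<subseteq> Q - K \<Longrightarrow> \<not> limitin X s \<one> sequentially"
    and A: "A \<subseteq> Q" and t: "t \<in> X closure_of A"
  shows "t \<in> X closure_of {a \<in> A. a \<otimes> inv t \<in> K}"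
proof -
  \<comment> \<open>Countability of \<open>D\<close> survives the union over a sequence and allows
    \<open>U2\<close> below to be enumerated.\<close>
  define B where "B = {t \<in> carrier G. \<exists>D. countable D \<and> D \<subseteq> {a \<in> A. a \<otimes> inv t \<in> K} \<and> t \<in> X closure_of D}"
  have KG: "K \<subseteq> carrier G" using compactin_subset_topspace[OF K(1)] by simp
  have Kc: "closedin X K" using compactin_imp_closedin[OF Hausdorff K(1)] .
  have AG: "A \<subseteq> carrier G" using A Q_sub by blast
  have "closedin X B"
  proof (rule sequential_space_closedinI[OF X])
    show "B \<subseteq> topspace X" by (auto simp: B_def)
    fix s b assume s: "range s \<subseteq> B" "limitin X s b sequentially"
    then have sG: "\<And>n. s n \<in> carrier G" and b: "b \<in> carrier G"
      using limitin_topspace[OF s(2)] by (auto simp: B_def)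
    have "\<forall>n. \<exists>D. countable D \<and> D \<subseteq> {a \<in> A. a \<otimes> inv (s n) \<in> K} \<and> s n \<in> X closure_of D"
      using s(1) B_def by blast
    then obtain D where D: "\<And>n. countable (D n)" "\<And>n. D n \<subseteq> {a \<in> A. a \<otimes> inv (s n) \<in> K}"
      "\<And>n. s n \<in> X closure_of (D n)" by metis
    define U where "U = (\<Union>n. D n)"
    have UA: "U \<subseteq> A" using D(2) by (auto simp: U_def)
    have bU: "b \<in> X closure_of U"
    proof (rule limitin_closedin[OF s(2)])
      have "s n \<in> X closure_of U" for n
        using D(3)[of n] closure_of_mono[of "D n" U X] U_def by blast
      then show "\<forall>\<^sub>F n in sequentially. s n \<in> X closure_of U" by simp
    qed auto
    \<comment> \<open>The good part \<open>U1\<close> is to witness \<open>b \<in> B\<close>. If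
      \<open>b\<close> is not in its closure, it is in the closure of the bad part
      \<open>U2\<close>.\<close>
    define U1 U2 where "U1 = {a \<in> U. a \<otimes> inv b \<in> K}" and "U2 = {a \<in> U. a \<otimes> inv b \<notin> K}"
    have cU: "countable U" using D(1) by (simp add: U_def)
    have "U = U1 \<union> U2" by (auto simp: U1_def U2_def)
    have "b \<in> X closure_of U1"
    proof (rule ccontr)
      assume "b \<notin> X closure_of U1"
      then have b2: "b \<in> X closure_of U2"
        using bU \<open>U = U1 \<union> U2\<close> by (simp add: closure_of_Un)
      have "countable U2" using cU by (simp add: U2_def)
      have "U2 \<noteq> {}" using b2 by auto
      define d where "d = from_nat_into U2"
      have rd: "range d = U2" using \<open>countable U2\<close> \<open>U2 \<noteq> {}\<close> by (simp add: d_def range_from_nat_into)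
      have dU: "d i \<in> U2" for i using rd by blast
      then have dG: "d i \<in> carrier G" for i using UA AG U2_def by blast
      \<comment> \<open>The points \<open>y\<close> with \<open>d i \<otimes> inv y \<in> K\<close>
        lie in a compact translate \<open>L\<close> of the inverse of \<open>K\<close>. It misses
        \<open>b\<close>, so the two can be separated.\<close>
      have "\<exists>Z. openin X Z \<and> b \<in> Z \<and> (\<forall>y \<in> X closure_of Z. d i \<otimes> inv y \<notin> K)" for i
      proof -
        define L where "L = (\<lambda>k. inv k \<otimes> d i) ` K"
        have "compactin X L" unfolding L_def
          using dG by (intro image_compactin[OF K(1)] continuous_map_mult continuous_inv) simp
        have L: "y \<in> L" if "y \<in> carrier G" "d i \<otimes> inv y \<in> K" for y
        proof -
          have "y = inv (d i \<otimes> inv y) \<otimes> d i"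
            using that dG by (simp add: inv_mult_group m_assoc)
          then show ?thesis using that L_def by blast
        qed
        have "b \<notin> L"
        proof
          assume "b \<in> L"
          then obtain k where k: "k \<in> K" "b = inv k \<otimes> d i" by (auto simp: L_def)
          then have "d i \<otimes> inv b = k"
            using KG dG[of i] by (auto simp: inv_mult_group m_assoc[symmetric])
          then show False using dU[of i] k by (simp add: U2_def)
        qed
        then have "disjnt {b} L" by simp
        then obtain Z1 Z2 where Z: "openin X Z1" "openin X Z2" "b \<in> Z1" "L \<subseteq> Z2" "disjnt Z1 Z2"
          using Hausdorff \<open>compactin X L\<close> b unfolding Hausdorff_space_compact_sets
          by (metis compactin_sing insert_subset topspace_eq)
        have "Z1 \<subseteq> carrier G - Z2" "closedin X (carrier G - Z2)"
          using Z openin_subset[OF Z(1)] openin_closedin_eq[of X Z2] by (auto simp: disjnt_iff)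
        then have "X closure_of Z1 \<subseteq> carrier G - Z2" by (rule closure_of_minimal)
        then show ?thesis using Z L by (intro exI[of _ Z1]) blast
      qed
      then obtain Y where Y: "\<And>i. openin X (Y i)" "\<And>i. b \<in> Y i"
        "\<And>i y. y \<in> X closure_of (Y i) \<Longrightarrow> d i \<otimes> inv y \<notin> K" by metis
      have "\<exists>y\<in>U2. \<forall>i\<le>n. y \<in> Y i" for n
      proof -
        have "openin X (\<Inter>i\<le>n. Y i)" using Y(1) by (intro openin_Inter) auto
        moreover have "b \<in> (\<Inter>i\<le>n. Y i)" using Y(2) by blast
        ultimately have "\<exists>y. y \<in> U2 \<and> y \<in> (\<Inter>i\<le>n. Y i)"
          using b2 unfolding in_closure_of by meson
        then show ?thesis by (metis INT_E atMost_iff)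
      qed
      then obtain y where y: "\<And>n. y n \<in> U2" "\<And>n i. i \<le> n \<Longrightarrow> y n \<in> Y i" by metis
      \<comment> \<open>Every \<open>z \<in> U\<close> factors as
        \<open>(z \<otimes> inv (s n)) \<otimes> s n\<close> with first factor in \<open>K\<close>,
        so \<open>y\<close> runs in a compact product.\<close>
      define C where "C = {k \<otimes> l | k l. k \<in> K \<and> l \<in> insert b (range s)}"
      have "compactin X (insert b (range s))"
        using s(2) sG by (intro compactin_sequence_with_limit) auto
      then have "compactin X C" unfolding C_def by (rule compactin_mult[OF K(1)])
      moreover have "range y \<subseteq> C"
      proof
        fix z assume "z \<in> range y"
        then have "z \<in> U" using y(1) U2_def by blast
        then obtain n where n: "z \<in> A" "z \<otimes> inv (s n) \<in> K" using D(2) U_def by blast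
        then have "z = (z \<otimes> inv (s n)) \<otimes> s n" using AG sG by (simp add: m_assoc subset_iff)
        then show "z \<in> C" using n(2) C_def by blast
      qed
      ultimately obtain k h where k: "filterlim k sequentially sequentially"
        and h: "limitin X (\<lambda>j. y (k j)) h sequentially"
        using sequential_compact_subsequence[OF X Hausdorff] by metis
      have "range (\<lambda>j. y (k j)) \<subseteq> Q" using y(1) U2_def UA A by blast
      then obtain j where j: "y (k j) \<otimes> inv h \<in> K"
        using convergent_sequence_meets_translate[OF Kc Q null _ h Q_sub] by blast
      \<comment> \<open>The term \<open>y (k j)\<close> is some \<open>d i\<close>, while almost all
        terms lie in \<open>Y i\<close>. Hence \<open>h\<close> is in the closure of
        \<open>Y i\<close>, and the choice of \<open>Y i\<close> excludes
        \<open>d i \<otimes> inv h \<in> K\<close>.\<close>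
      obtain i where i: "y (k j) = d i" using y(1) rd by (metis imageE)
      have "\<forall>\<^sub>F j in sequentially. k j \<ge> i" using k unfolding filterlim_at_top by blast
      then have "\<forall>\<^sub>F j in sequentially. y (k j) \<in> X closure_of (Y i)"
        using y(2) closure_of_subset[OF openin_subset[OF Y(1)[of i]]] by (auto elim!: eventually_mono)
      then have "h \<in> X closure_of (Y i)"
        using limitin_closedin[OF h closedin_closure_of] by simp
      then show False using Y(3) i j by metis
    qed
    moreover have "countable U1" using cU by (simp add: U1_def)
    ultimately show "b \<in> B" using b UA by (auto simp: B_def U1_def intro!: exI[of _ U1])
  qed
  moreover have "A \<subseteq> B"
  proof
    fix a assume "a \<in> A"
    then have "a \<in> carrier G" using AG by blast
    then have "{a} \<subseteq> {x \<in> A. x \<otimes> inv a \<in> K}" "a \<in> X closure_of {a}"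
      using \<open>a \<in> A\<close> K(2) closure_of_subset[of "{a}" X] by auto
    then show "a \<in> B" using \<open>a \<in> carrier G\<close> by (auto simp: B_def intro!: exI[of _ "{a}"])
  qed
  ultimately have "t \<in> B" using t closure_of_minimal by blast
  then show ?thesis unfolding B_def using closure_of_mono by blast
qed

text \<open>For \<open>A = Q - K\<close> and \<open>t = \<one>\<close> the set in
  \<open>closure_of_Int_translate\<close> is empty, so a neighbourhood of \<open>\<one>\<close>
  misses \<open>Q - K\<close>. Removing \<open>K\<close> from it leaves an open set disjoint from
  the dense set \<open>Q\<close>.\<close>

lemma compact_neighbourhood_of_one:
  assumes X: "sequential_space X" and K: "compactin X K" "\<one> \<in> K"
    and Q_sub: "Q \<subseteq> carrier G" and Q: "\<And>a b. a \<in> Q \<Longrightarrow> b \<in> Q \<Longrightarrow> a \<otimes> inv b \<in> Q"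
    and dense: "X closure_of Q = carrier G"
    and null: "\<And>s. range s \<subseteq> Q - K \<Longrightarrow> \<not> limitin X s \<one> sequentially"
  obtains U where "openin X U" "\<one> \<in> U" "U \<subseteq> K"
proof -
  define U where "U = carrier G - X closure_of (Q - K)"
  have "\<one> \<notin> X closure_of (Q - K)"
  proof
    assume "\<one> \<in> X closure_of (Q - K)"
    then have "\<one> \<in> X closure_of {a \<in> Q - K. a \<otimes> inv \<one> \<in> K}"
      by (intro closure_of_Int_translate[OF X K Q_sub Q null]) auto
    moreover have "{a \<in> Q - K. a \<otimes> inv \<one> \<in> K} = {}" using Q_sub by (auto simp: subset_iff)
    ultimately show False by (simp only: closure_of_empty empty_iff)
  qed
  then have 1: "\<one> \<in> U" by (simp add: U_def)
  have opU: "openin X U" unfolding U_def using openin_diff[OF openin_topspace closedin_closure_of, of X] by simp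
  have "openin X (U - K)"
    using opU compactin_imp_closedin[OF Hausdorff K(1)] by (rule openin_diff)
  moreover have "Q \<inter> (U - K) = {}"
    using closure_of_subset[of "Q - K" X] Q_sub by (auto simp: U_def)
  ultimately have "U - K = {}"
    using dense openin_Int_closure_of_eq_empty openin_subset by (metis inf.absorb_iff1 inf_commute topspace_eq)
  then show ?thesis using that opU 1 by blast
qed

text \<open>A countable local \<pi>-base at \<open>\<one>\<close> becomes a countable neighbourhood
  base \<open>N m\<close> at any \<open>x\<close>; points of \<open>A\<close> picked in its finite
  intersections converge to \<open>x\<close>.\<close>

lemma Frechet_if_compact_neighbourhood:
  assumes X: "sequential_space X" and K: "compactin X K" and U: "openin X U" "\<one> \<in> U" "U \<subseteq> K"
  shows "Frechet_space X"
proof -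
  have KG: "K \<subseteq> carrier G" using compactin_subset_topspace[OF K] by simp
  have Kc: "closedin X K" using compactin_imp_closedin[OF Hausdorff K] .
  obtain \<C> where C: "countable \<C>" "\<And>W. W \<in> \<C> \<Longrightarrow> openin (subtopology X K) W \<and> W \<noteq> {}"
    "\<And>Z. openin (subtopology X K) Z \<Longrightarrow> \<one> \<in> Z \<Longrightarrow> \<exists>W\<in>\<C>. W \<subseteq> Z"
  proof (rule countable_local_pi_base)
    show "compact_space (subtopology X K)" by (rule compact_space_subtopology[OF K])
    show "Hausdorff_space (subtopology X K)" by (rule Hausdorff_space_subtopology[OF Hausdorff])
    show "sequential_space (subtopology X K)" by (rule sequential_space_closed_subtopology[OF X Kc])
    show "\<one> \<in> topspace (subtopology X K)" using U by auto
  qed blast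
  \<comment> \<open>Members inside \<open>U\<close> are open in \<open>X\<close> and not only in
    \<open>K\<close>, because \<open>U\<close> is open in \<open>X\<close> and contained in
    \<open>K\<close>.\<close>
  define \<D> where "\<D> = {W \<in> \<C>. W \<subseteq> U}"
  have Dop: "openin X W" "W \<noteq> {}" if W: "W \<in> \<D>" for W
  proof -
    obtain T where T: "openin X T" "W = T \<inter> K"
      using C(2) W unfolding \<D>_def openin_subtopology by blast
    then have "W = T \<inter> U" using W U(3) by (auto simp: \<D>_def)
    then show "openin X W" using T U(1) by blast
    show "W \<noteq> {}" using C(2) W by (auto simp: \<D>_def)
  qed
  have D: "\<exists>W\<in>\<D>. W \<subseteq> Z" if "openin X Z" "\<one> \<in> Z" for Z
  proof -
    have "openin (subtopology X K) (Z \<inter> U)"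
      using that U by (metis inf.absorb_iff1 inf.coboundedI2 openin_Int openin_subtopology)
    then show ?thesis using C(3)[of "Z \<inter> U"] that U(2) by (auto simp: \<D>_def)
  qed
  have "\<D> \<noteq> {}" using D U(1,2) by blast
  moreover have "countable \<D>" using C(1) by (auto simp: \<D>_def)
  ultimately obtain W :: "nat \<Rightarrow> 'a set" where W: "range W = \<D>"
    using range_from_nat_into by metis
  show ?thesis
    unfolding Frechet_space_def
  proof (intro allI impI, elim conjE)
    fix A x assume A: "A \<subseteq> topspace X" "x \<in> X closure_of A"
    then have x: "x \<in> carrier G" using in_closure_of[of x X A] by simp
    \<comment> \<open>With \<open>w = inv x \<otimes> y \<otimes> v\<close> one has
      \<open>y = x \<otimes> w \<otimes> inv v\<close>, so \<open>N m\<close> is \<open>x\<close>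
      times the quotients of \<open>W m\<close>. It contains \<open>x\<close> even if
      \<open>\<one> \<notin> W m\<close>.\<close>
    define N where "N m = {y \<in> carrier G. \<exists>v\<in>W m. inv x \<otimes> y \<otimes> v \<in> W m}" for m
    have WG: "W m \<subseteq> carrier G" for m
      using Dop(1) W openin_subset by (metis rangeI topspace_eq)
    have Nop: "openin X (N m)" for m
    proof -
      have "N m = (\<Union>v\<in>W m. {y \<in> topspace X. inv x \<otimes> y \<otimes> v \<in> W m})" by (auto simp: N_def)
      moreover have "openin X {y \<in> topspace X. inv x \<otimes> y \<otimes> v \<in> W m}" if "v \<in> W m" for v
      proof (rule openin_continuous_map_preimage)
        show "continuous_map X X (\<lambda>y. inv x \<otimes> y \<otimes> v)"
          using that x WG by (intro continuous_map_mult continuous_map_id[unfolded id_def]) auto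
        show "openin X (W m)" using Dop(1) W by blast
      qed
      ultimately show ?thesis by auto
    qed
    have xN: "x \<in> N m" for m
    proof -
      obtain v where v: "v \<in> W m" using Dop(2) W by blast
      then have "v \<in> carrier G" using WG by blast
      then have "inv x \<otimes> x \<otimes> v \<in> W m" using v x by simp
      then show ?thesis using v x unfolding N_def by blast
    qed
    have "\<exists>y\<in>A. \<forall>m\<le>n. y \<in> N m" for n
    proof -
      have "openin X (\<Inter>m\<le>n. N m)" using Nop by (intro openin_Inter) auto
      moreover have "x \<in> (\<Inter>m\<le>n. N m)" using xN by blast
      ultimately have "\<exists>y. y \<in> A \<and> y \<in> (\<Inter>m\<le>n. N m)"
        using A(2) unfolding in_closure_of by meson
      then show ?thesis by (metis INT_E atMost_iff)
    qed
    then obtain s where s: "\<And>n. s n \<in> A" "\<And>n m. m \<le> n \<Longrightarrow> s n \<in> N m" by metis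
    have "limitin X s x sequentially"
      unfolding limitin_sequentially
    proof (intro conjI allI impI; (elim conjE)?)
      show "x \<in> topspace X" using x by simp
      fix Z assume Z: "openin X Z" "x \<in> Z"
      \<comment> \<open>Continuity of \<open>x \<otimes> a \<otimes> inv b\<close> in
        \<open>(a, b)\<close> at \<open>(\<one>, \<one>)\<close> gives \<open>U1\<close> and
        \<open>U2\<close>; a \<open>W m\<close> inside both yields
        \<open>N m \<subseteq> Z\<close>.\<close>
      define M where "M = {p \<in> topspace (prod_topology X X). x \<otimes> fst p \<otimes> inv (snd p) \<in> Z}"
      have "continuous_map (prod_topology X X) X (\<lambda>p. x \<otimes> fst p \<otimes> inv (snd p))"
        using x by (intro continuous_map_mult continuous_map_inv continuous_map_fst continuous_map_snd) simp
      then have "openin (prod_topology X X) M"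
        unfolding M_def using Z(1) by (rule openin_continuous_map_preimage)
      moreover have "(\<one>, \<one>) \<in> M" using x Z by (simp add: M_def)
      ultimately obtain U1 U2 where U12: "openin X U1" "openin X U2" "\<one> \<in> U1" "\<one> \<in> U2" "U1 \<times> U2 \<subseteq> M"
        unfolding openin_prod_topology_alt by meson
      have "\<exists>V\<in>\<D>. V \<subseteq> U1 \<inter> U2" using U12 by (intro D openin_Int IntI)
      then obtain m where m: "W m \<subseteq> U1 \<inter> U2" using W by (metis imageE)
      have "y \<in> Z" if y: "y \<in> N m" for y
      proof -
        obtain v where v: "v \<in> W m" "inv x \<otimes> y \<otimes> v \<in> W m" "y \<in> carrier G"
          using y unfolding N_def by blast
        have "(inv x \<otimes> y \<otimes> v, v) \<in> U1 \<times> U2" using v(1,2) m by blast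
        then have "(inv x \<otimes> y \<otimes> v, v) \<in> M" by (rule subsetD[OF U12(5)])
        then have vZ: "x \<otimes> (inv x \<otimes> y \<otimes> v) \<otimes> inv v \<in> Z" by (simp add: M_def)
        have "v \<in> carrier G" using v WG by blast
        then have "x \<otimes> (inv x \<otimes> y \<otimes> v) \<otimes> inv v = x \<otimes> (inv x \<otimes> y)"
          using x v(3) by (simp add: m_assoc)
        also have "\<dots> = y" using x v(3) by (simp add: m_assoc[symmetric])
        finally show ?thesis using vZ by simp
      qed
      then show "\<exists>n. \<forall>k\<ge>n. s k \<in> Z" using s(2) by metis
    qed
    then show "\<exists>s. range s \<subseteq> A \<and> limitin X s x sequentially" using s(1) by blast
  qed
qed

end

section \<open>Sequential fans in \<open>k\<^sub>\<omega>\<close> spaces\<close>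

text \<open>This trades the topologies \<open>\<tau> K\<close> for that of \<open>X\<close>: the
  identity from \<open>\<tau> K\<close> to \<open>X\<close> is continuous, so the pieces are compact
  in \<open>X\<close>, and closedness is tested by comparison with closed sets of
  \<open>X\<close>.\<close>

lemma k_omega_compact_exhaustion:
  assumes "k_omega_space X" "topspace X \<noteq> {}"
  obtains F :: "nat \<Rightarrow> 'a set"
  where "\<And>n. compactin X (F n)"
    and "\<And>C. C \<subseteq> topspace X \<Longrightarrow> (\<And>n. \<exists>D. closedin X D \<and> C \<inter> F n = D \<inter> F n) \<Longrightarrow> closedin X C"
proof -
  obtain \<K> \<tau> where \<K>: "countable \<K>" "\<Union>\<K> = topspace X" "determined_by X \<K> \<tau>"
    "\<And>K. K \<in> \<K> \<Longrightarrow> compact_space (\<tau> K)"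
    using assms(1) unfolding k_omega_space_def
    by (elim exE conjE) (rule that, assumption+, drule (1) bspec, erule conjunct1)
  have top: "K \<subseteq> topspace X" "topspace (\<tau> K) = K" if "K \<in> \<K>" for K
    using \<K>(3) that unfolding determined_by_def by auto
  have op: "openin X U \<longleftrightarrow> (\<forall>K\<in>\<K>. openin (\<tau> K) (U \<inter> K))" if "U \<subseteq> topspace X" for U
    using mp[OF spec[OF conjunct2[OF \<K>(3)[unfolded determined_by_def]]] that] .
  have "\<K> \<noteq> {}" using \<K>(2) assms(2) by (metis Union_empty)
  then obtain F :: "nat \<Rightarrow> 'a set" where F: "range F = \<K>"
    using \<K>(1) range_from_nat_into by metis
  have cpt: "compactin X K" if K: "K \<in> \<K>" for K
  proof -
    have "continuous_map (\<tau> K) X id"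
    proof (rule continuous_map[THEN iffD2], intro conjI allI impI)
      show "id ` topspace (\<tau> K) \<subseteq> topspace X" using top[OF K] by simp
      fix U assume U: "openin X U"
      then have "openin (\<tau> K) (U \<inter> K)" using op K openin_subset by metis
      moreover have "{x \<in> topspace (\<tau> K). id x \<in> U} = U \<inter> K" using top[OF K] by auto
      ultimately show "openin (\<tau> K) {x \<in> topspace (\<tau> K). id x \<in> U}" by simp
    qed
    then show ?thesis
      using image_compactin[of "\<tau> K" K X id] \<K>(4)[OF K] top(2)[OF K] by (simp add: compact_space_def)
  qed
  have closed: "closedin X C"
    if C: "C \<subseteq> topspace X" "\<And>n. \<exists>D. closedin X D \<and> C \<inter> F n = D \<inter> F n" for C
  proof -
    have "openin (\<tau> K) ((topspace X - C) \<inter> K)" if K: "K \<in> \<K>" for K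
    proof -
      obtain n where "K = F n" using K F by blast
      then obtain D where D: "closedin X D" "C \<inter> K = D \<inter> K" using C(2) by blast
      then have "openin X (topspace X - D)" by blast
      then have "openin (\<tau> K) ((topspace X - D) \<inter> K)" using op K openin_subset by metis
      moreover have "(topspace X - D) \<inter> K = (topspace X - C) \<inter> K" using D(2) by blast
      ultimately show ?thesis by simp
    qed
    then have "openin X (topspace X - C)" by (subst op) auto
    then show ?thesis using C(1) by (simp add: closedin_def)
  qed
  show ?thesis
  proof (rule that[of F])
    show "compactin X (F n)" for n using cpt F by blast
  qed (rule closed)
qed

text \<open>The member of a cover that contains \<open>p\<close> leaves only finitely many points to
  be covered.\<close>

lemma compactin_insert_limit:
  assumes p: "p \<in> topspace X"
    and R: "R \<subseteq> topspace X" "\<And>U. openin X U \<Longrightarrow> p \<in> U \<Longrightarrow> finite (R - U)"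
  shows "compactin X (insert p R)"
  unfolding compactin_def
proof (intro conjI allI impI; (elim conjE)?)
  show "insert p R \<subseteq> topspace X" using p R by blast
  fix \<U> assume op: "\<forall>U\<in>\<U>. openin X U" and cov: "insert p R \<subseteq> \<Union>\<U>"
  then obtain U where U: "U \<in> \<U>" "p \<in> U" by blast
  have "finite (R - U)" using R(2) op U by blast
  moreover have "R - U \<subseteq> \<Union>\<U>" using cov by blast
  ultimately obtain \<F> where "finite \<F>" "\<F> \<subseteq> \<U>" "R - U \<subseteq> \<Union>\<F>"
    by (rule finite_subset_Union)
  then show "\<exists>\<F>. finite \<F> \<and> \<F> \<subseteq> \<U> \<and> insert p R \<subseteq> \<Union>\<F>"
    using U by (intro exI[of _ "insert U \<F>"]) auto
qed

text \<open>The column \<open>R n\<close> avoids a compact set \<open>L n\<close> containing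
  \<open>F n\<close>, so \<open>F n\<close> meets only columns of index below
  \<open>n\<close>.\<close>

lemma sequential_fan_in_k_omega:
  fixes X :: "'a topology"
  assumes X: "Hausdorff_space X" "k_omega_space X" and p: "p \<in> topspace X" "p \<in> Q"
    and Q: "Q \<subseteq> topspace X"
    and seq: "\<And>K. compactin X K \<Longrightarrow> p \<in> K \<Longrightarrow> \<exists>s. range s \<subseteq> Q - K \<and> limitin X s p sequentially"
  shows "\<exists>S. S \<subseteq> Q \<and> subtopology X S homeomorphic_space sequential_fan \<and> closedin X S"
proof -
  obtain F :: "nat \<Rightarrow> 'a set" where F: "\<And>n. compactin X (F n)"
    and Fc: "\<And>C. C \<subseteq> topspace X \<Longrightarrow> (\<And>n. \<exists>D. closedin X D \<and> C \<inter> F n = D \<inter> F n) \<Longrightarrow> closedin X C"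
    using k_omega_compact_exhaustion[OF X(2)] p by (metis empty_iff)
  \<comment> \<open>Columns are sets converging to \<open>p\<close> rather than sequences, so that
    they can later be enumerated without repetition.\<close>
  define N where "N R \<longleftrightarrow> R \<subseteq> Q \<and> infinite R \<and> countable R \<and> (\<forall>U. openin X U \<and> p \<in> U \<longrightarrow> finite (R - U))" for R
  have ex: "\<exists>R. N R \<and> R \<inter> K = {}" if "compactin X K" "p \<in> K" for K
  proof -
    obtain s where s: "range s \<subseteq> Q - K" "limitin X s p sequentially" using seq \<open>compactin X K\<close> \<open>p \<in> K\<close> by blast
    have fin: "finite (range s - U)" if U: "openin X U" "p \<in> U" for U
    proof -
      obtain n where "\<And>m. m \<ge> n \<Longrightarrow> s m \<in> U" using s(2) U unfolding limitin_sequentially by blast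
      then have "range s - U \<subseteq> s ` {..<n}" by (auto simp: not_le) (metis imageI lessThan_iff not_le)
      then show ?thesis by (rule finite_subset) simp
    qed
    have "infinite (range s)"
    proof
      assume "finite (range s)"
      then have "closedin X (range s)"
        using X(1) Q s(1) by (intro closedin_Hausdorff_finite) auto
      then have "p \<in> range s" using limitin_closedin[OF s(2)] by simp
      then show False using s(1) that by blast
    qed
    then show ?thesis using fin s(1) unfolding N_def by (intro exI[of _ "range s"]) auto
  qed
  have NK: "compactin X (insert p R)" if "N R" for R
    using that Q by (intro compactin_insert_limit p) (auto simp: N_def)
  define pick where "pick K = (SOME R. N R \<and> R \<inter> K = {})" for K
  have pick: "N (pick K)" "pick K \<inter> K = {}" if "compactin X K" "p \<in> K" for K
    using someI_ex[OF ex[OF that]] by (auto simp: pick_def)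
  \<comment> \<open>\<open>L n\<close> collects \<open>p\<close>, the sets \<open>F 0\<close> to
    \<open>F n\<close> and the columns picked so far; the next column avoids all of these.\<close>
  define L where "L = rec_nat (insert p (F 0)) (\<lambda>n K. K \<union> pick K \<union> F (Suc n))"
  have L0: "L 0 = insert p (F 0)" and LS: "L (Suc n) = L n \<union> pick (L n) \<union> F (Suc n)" for n
    by (simp_all add: L_def)
  have L: "compactin X (L n) \<and> p \<in> L n" for n
  proof (induction n)
    case 0
    have "compactin X ({p} \<union> F 0)" using F p by (intro compactin_Un) auto
    then show ?case by (simp add: L0)
  next
    case (Suc n)
    then have "compactin X (L n \<union> insert p (pick (L n)) \<union> F (Suc n))"
      using F NK pick by (intro compactin_Un) auto
    moreover have "L n \<union> insert p (pick (L n)) \<union> F (Suc n) = L (Suc n)" using Suc by (auto simp: LS)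
    ultimately show ?case using Suc by (auto simp: LS)
  qed
  define R where "R n = pick (L n)" for n
  have NR: "N (R n)" and RL: "R n \<inter> L n = {}" for n using pick L by (auto simp: R_def)
  have Lmono: "L m \<subseteq> L n" if "m \<le> n" for m n
    using that by (rule lift_Suc_mono_le[rotated]) (auto simp: LS)
  have FL: "F n \<subseteq> L n" for n by (cases n) (auto simp: L0 LS)
  have RF: "R k \<inter> F n = {}" if "n \<le> k" for n k using FL[of n] Lmono[OF that] RL[of k] by blast
  have RR: "R i \<inter> R k = {}" if "i \<noteq> k" for i k
  proof -
    have "R i \<inter> R k = {}" if "i < k" for i k
    proof -
      have "R i \<subseteq> L (Suc i)" by (auto simp: LS R_def)
      then show ?thesis using Lmono[of "Suc i" k] RL[of k] that by force
    qed
    then show ?thesis using that by (metis inf_commute linorder_neqE_nat)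
  qed
  have pR: "p \<notin> R n" for n using RL[of n] L[of n] by blast
  define S where "S = insert p (\<Union>n. R n)"
  have SQ: "S \<subseteq> Q" using p NR by (auto simp: S_def N_def)
  then have SX: "S \<subseteq> topspace X" using Q by blast
  have RX: "R n \<subseteq> topspace X" for n using SX by (auto simp: S_def)
  \<comment> \<open>This criterion serves both for \<open>S\<close> itself and for the complements
    of images under \<open>h\<close>. On \<open>F n\<close>, \<open>C\<close> agrees with its part
    \<open>D\<close> in the first \<open>n\<close> columns, which is compact because it contains
    \<open>p\<close> or is finite.\<close>
  have closed: "closedin X C" if C: "C \<subseteq> S" "p \<in> C \<or> (\<forall>n. finite (C \<inter> R n))" for C
  proof (rule Fc)
    show "C \<subseteq> topspace X" using C(1) SX by blast
    fix n
    define D where "D = (C \<inter> {p}) \<union> (\<Union>i<n. C \<inter> R i)"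
    have "compactin X D"
    proof (cases "p \<in> C")
      case True
      have "compactin X (insert p (C \<inter> R i))" for i
      proof (rule compactin_insert_limit[OF p(1)])
        show "C \<inter> R i \<subseteq> topspace X" using RX by blast
        show "finite (C \<inter> R i - U)" if "openin X U" "p \<in> U" for U
          using NR[of i] that unfolding N_def by (meson Diff_mono finite_subset inf_le2 order_refl)
      qed
      then have "compactin X (\<Union>((\<lambda>i. insert p (C \<inter> R i)) ` {..<n}))" "compactin X {p}"
        using p(1) by (auto intro!: compactin_Union simp del: UN_insert UN_simps)
      then have "compactin X ({p} \<union> (\<Union>i<n. insert p (C \<inter> R i)))" by (intro compactin_Un)
      moreover have "{p} \<union> (\<Union>i<n. insert p (C \<inter> R i)) = D" using True by (auto simp: D_def)
      ultimately show ?thesis by simp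
    next
      case False
      then have "finite (C \<inter> R i)" for i using C(2) by blast
      then have "finite D" unfolding D_def by (intro finite_UnI finite_UN_I) simp_all
      moreover have "D \<subseteq> C" by (simp add: D_def UN_subset_iff)
      then have "D \<subseteq> topspace X" using C(1) SX by (metis subset_trans)
      ultimately show ?thesis by (simp add: finite_imp_compactin)
    qed
    then have "closedin X D" by (rule compactin_imp_closedin[OF X(1)])
    moreover have "C \<inter> F n = D \<inter> F n"
    proof -
      have "x \<in> D" if x: "x \<in> C" "x \<in> F n" for x
      proof (cases "x = p")
        case False
        then obtain i where i: "x \<in> R i" using x C(1) by (auto simp: S_def)
        then have "i < n" using RF[of n i] x by (metis IntI empty_iff not_le)
        then show ?thesis using i x by (auto simp: D_def)
      qed (use x in \<open>auto simp: D_def\<close>)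
      then show ?thesis by (auto simp: D_def)
    qed
    ultimately show "\<exists>D. closedin X D \<and> C \<inter> F n = D \<inter> F n" by blast
  qed
  define f where "f i = from_nat_into (R i)" for i
  have f: "bij_betw (f i) UNIV (R i)" for i
    unfolding f_def using NR[of i] by (intro bij_betw_from_nat_into) (auto simp: N_def)
  have fR: "f i j \<in> R i" for i j using f[of i] by (auto simp: bij_betw_def)
  have f_inj: "f i j = f i' j' \<longleftrightarrow> i = i' \<and> j = j'" for i j i' j'
  proof
    assume eq: "f i j = f i' j'"
    then have "i = i'" using fR RR by (metis IntI empty_iff)
    then show "i = i' \<and> j = j'" using eq f[of i] by (auto simp: bij_betw_def inj_on_def)
  qed simp
  define h where "h = case_option p (\<lambda>(i, j). f i j)"
  have h: "h None = p" "h (Some (i, j)) = f i j" for i j by (simp_all add: h_def)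
  have fp: "f i j \<noteq> p" for i j using fR pR by metis
  have h_inj: "inj h"
  proof (rule injI)
    fix x y assume eq: "h x = h y"
    show "x = y"
    proof (cases x; cases y)
      fix a b assume "x = Some a" "y = Some b"
      then show ?thesis using eq f_inj by (cases a; cases b) (simp add: h)
    next
      fix a assume "x = Some a" "y = None"
      then show ?thesis using eq fp by (cases a) (simp add: h)
    next
      fix b assume "x = None" "y = Some b"
      then show ?thesis using eq fp[symmetric] by (cases b) (simp add: h)
    qed simp
  qed
  have h_range: "range h = S"
  proof
    have "h x \<in> S" for x
    proof (cases x)
      case (Some a)
      then show ?thesis using fR by (cases a) (auto simp: h S_def)
    qed (simp add: h S_def)
    then show "range h \<subseteq> S" by blast
    show "S \<subseteq> range h"
    proof
      fix x assume "x \<in> S"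
      then consider "x = p" | i where "x \<in> R i" by (auto simp: S_def)
      then show "x \<in> range h"
      proof cases
        case 1
        then show ?thesis using h(1) by (metis rangeI)
      next
        case 2
        then obtain j where "x = f i j" using f[of i] by (auto simp: bij_betw_def)
        then show ?thesis using h(2) by (metis rangeI)
      qed
    qed
  qed
  have "homeomorphic_map sequential_fan (subtopology X S) h"
  proof (rule bijective_open_imp_homeomorphic_map)
    show "h ` topspace sequential_fan = topspace (subtopology X S)"
      using h_range SX by auto
    show "inj_on h (topspace sequential_fan)" using h_inj by simp
    show "continuous_map sequential_fan (subtopology X S) h"
      unfolding continuous_map_in_subtopology
    proof
      show "continuous_map sequential_fan X h"
      proof (rule continuous_map[THEN iffD2], intro conjI allI impI)
        show "h ` topspace sequential_fan \<subseteq> topspace X" using h_range SX by simp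
        fix U assume U: "openin X U"
        show "openin sequential_fan {x \<in> topspace sequential_fan. h x \<in> U}"
          unfolding openin_sequential_fan
        proof
          assume "None \<in> {x \<in> topspace sequential_fan. h x \<in> U}"
          then have "p \<in> U" by (simp add: h)
          have "\<exists>m. \<forall>j\<ge>m. f i j \<in> U" for i
          proof -
            have "finite (R i - U)" using NR U \<open>p \<in> U\<close> by (auto simp: N_def)
            then have "finite (f i -` (R i - U))"
              using f[of i] by (intro finite_vimageI) (auto simp: bij_betw_def)
            then obtain m where "\<forall>j\<in>f i -` (R i - U). j < m"
              using finite_nat_set_iff_bounded by blast
            then show ?thesis using fR by (metis DiffI not_le vimageI)
          qed
          then obtain g where "\<And>i j. j \<ge> g i \<Longrightarrow> f i j \<in> U" by metis
          then show "\<exists>g. fan_nhd g \<subseteq> {x \<in> topspace sequential_fan. h x \<in> U}"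
            using \<open>p \<in> U\<close> by (intro exI[of _ g]) (auto simp: fan_nhd_def h)
        qed
      qed
      show "h \<in> topspace sequential_fan \<rightarrow> S" using h_range by auto
    qed
    show "open_map sequential_fan (subtopology X S) h"
      unfolding open_map_def
    proof (intro allI impI)
      fix V assume V: "openin sequential_fan V"
      have hV: "h ` V \<subseteq> S" using h_range by blast
      \<comment> \<open>The complement contains \<open>p\<close> when
        \<open>None \<notin> V\<close>; otherwise a basic neighbourhood inside \<open>V\<close>
        leaves finitely many points in each column.\<close>
      have "closedin X (S - h ` V)"
      proof (rule closed)
        show "p \<in> S - h ` V \<or> (\<forall>n. finite ((S - h ` V) \<inter> R n))"
        proof (cases "None \<in> V")
          case True
          then obtain g where g: "fan_nhd g \<subseteq> V" using V openin_sequential_fan by blast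
          have "(S - h ` V) \<inter> R n \<subseteq> f n ` {..<g n}" for n
          proof
            fix x assume x: "x \<in> (S - h ` V) \<inter> R n"
            then obtain j where j: "x = f n j" using f[of n] by (auto simp: bij_betw_def)
            have "\<not> g n \<le> j"
            proof
              assume "g n \<le> j"
              then have "Some (n, j) \<in> V" using g by (auto simp: fan_nhd_def)
              then show False using x j h(2) by (metis DiffD2 IntD1 imageI)
            qed
            then show "x \<in> f n ` {..<g n}" using j by auto
          qed
          then show ?thesis by (meson finite_imageI finite_lessThan finite_subset)
        next
          case False
          then have "p \<notin> h ` V" using h(1) h_inj by (metis image_iff injD)
          then show ?thesis by (simp add: S_def)
        qed
      qed blast
      then have "closedin (subtopology X S) (S - h ` V)"
        by (simp add: closedin_closed_subtopology closedin_subset_topspace)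
      then have "openin (subtopology X S) (topspace (subtopology X S) - (S - h ` V))" by blast
      moreover have "topspace (subtopology X S) - (S - h ` V) = h ` V" using hV SX by auto
      ultimately show "openin (subtopology X S) (h ` V)" by simp
    qed
  qed
  then have "subtopology X S homeomorphic_space sequential_fan"
    using homeomorphic_map_imp_homeomorphic_space homeomorphic_space_sym by blast
  moreover have "closedin X S" by (rule closed) (auto simp: S_def)
  ultimately show ?thesis using SQ by blast
qed

section \<open>The dichotomy in the closure of the subgroup\<close>

theorem proposition2:
  fixes G :: "('a, 'b) monoid_scheme" and T :: "'a topology" and G' :: "'a set"
  assumes "topological_group G T"
    and "subgroup G' G"
    and "k_omega_group (G\<lparr>carrier := T closure_of G'\<rparr>) (subtopology T (T closure_of G'))"
    and "sequential_space (subtopology T (T closure_of G'))"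
    and "\<not> Frechet_space (subtopology T (T closure_of G'))"
  shows "\<exists>S. S \<subseteq> G' \<and> subtopology T S homeomorphic_space sequential_fan \<and> closedin T S"
proof -
  define H where "H = T closure_of G'"
  define M where "M = G\<lparr>carrier := H\<rparr>"
  define X where "X = subtopology T H"
  have tg: "topological_group M X" and kw: "k_omega_space X"
    using assms(3) by (simp_all add: k_omega_group_def M_def X_def H_def)
  interpret topgroup M X
    using tg by (auto simp: topgroup_def topgroup_axioms_def topological_group_def)
  have G: "group G" "topspace T = carrier G" using assms(1) by (auto simp: topological_group_def)
  have HG: "H \<subseteq> carrier G" using G(2) closure_of_subset_topspace H_def by metis
  have G'H: "G' \<subseteq> H"
    unfolding H_def using subgroup.subset[OF assms(2)] G(2) by (intro closure_of_subset) simp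
  have M: "carrier M = H" "mult M = mult G" "one M = one G" by (simp_all add: M_def)
  \<comment> \<open>Inverses in \<open>M\<close> are taken relative to the carrier \<open>H\<close>;
    identifying them with those of \<open>G\<close> transfers closure of \<open>G'\<close> under
    quotients to \<open>M\<close>.\<close>
  have inv_eq: "inv\<^bsub>M\<^esub> x = inv\<^bsub>G\<^esub> x" if x: "x \<in> G'" for x
  proof (rule inv_equality)
    have xG: "x \<in> carrier G" using x G'H HG by blast
    show "inv\<^bsub>G\<^esub> x \<otimes>\<^bsub>M\<^esub> x = \<one>\<^bsub>M\<^esub>" using group.l_inv[OF G(1) xG] by (simp add: M)
    show "x \<in> carrier M" "inv\<^bsub>G\<^esub> x \<in> carrier M"
      using x G'H subgroup.m_inv_closed[OF assms(2) x] by (auto simp: M)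
  qed
  have Q: "a \<otimes>\<^bsub>M\<^esub> inv\<^bsub>M\<^esub> b \<in> G'" if "a \<in> G'" "b \<in> G'" for a b
    using that subgroup.m_closed[OF assms(2)] subgroup.m_inv_closed[OF assms(2)] by (simp add: M inv_eq)
  have dense: "X closure_of G' = carrier M"
    using G'H by (simp add: X_def M closure_of_subtopology H_def Int_absorb1)
  \<comment> \<open>Otherwise no null sequence of \<open>G'\<close> avoids \<open>K\<close>, which
    makes \<open>K\<close> a neighbourhood of the identity and \<open>X\<close> Frechet.\<close>
  have "\<exists>s. range s \<subseteq> G' - K \<and> limitin X s \<one>\<^bsub>M\<^esub> sequentially" if K: "compactin X K" "\<one>\<^bsub>M\<^esub> \<in> K" for K
  proof (rule ccontr)
    assume "\<not> ?thesis"
    then obtain U where "openin X U" "\<one>\<^bsub>M\<^esub> \<in> U" "U \<subseteq> K"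
      using compact_neighbourhood_of_one[of K G'] assms(4) K Q dense G'H X_def H_def M(1) by metis
    then have "Frechet_space X"
      using Frechet_if_compact_neighbourhood K(1) assms(4) X_def H_def by blast
    then show False using assms(5) by (simp add: X_def H_def)
  qed
  moreover have "\<one>\<^bsub>M\<^esub> \<in> G'" using subgroup.one_closed[OF assms(2)] by (simp add: M)
  ultimately obtain S where S: "S \<subseteq> G'" "subtopology X S homeomorphic_space sequential_fan" "closedin X S"
    using sequential_fan_in_k_omega[OF Hausdorff kw, of "\<one>\<^bsub>M\<^esub>" G'] G'H M(1) by auto
  have "subtopology X S = subtopology T S"
    using S(1) G'H by (simp add: X_def subtopology_subtopology Int_absorb1)
  \<comment> \<open>\<open>H\<close> is a closure, hence closed in \<open>T\<close>, so sets closed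
    in \<open>X\<close> are closed in \<open>T\<close>.\<close>
  moreover have "closedin T S"
    using S(3) closedin_trans_full[of T H S] by (simp add: X_def H_def)
  ultimately show ?thesis using S by auto
qed

end
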